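(* Let $\mathbf{x}=(x_1,\ldots,x_{d+1})$, $\mathbf{n}=(n_1,\ldots,n_{d+1}) \in \mathbb{N}^{d+1}$ and denote by $\mathrm{FCP}(\mathbf{n})$ the set of fully complementary $d$-dimensional partitions inside a $(2n_1,\ldots,2n_{d+1})$-box. Then \begin{equation*} \sum_{\mathbf{n} \in \mathbb{N}^{d+1}} |\mathrm{FCP}(\mathbf{n})| \mathbf{x}^{\mathbf{n}} = \frac{\prod\limits_{i=1}^{d+1}x_i\left( \sum\limits_{i=1}^{d+1}\left(x_i^{-1}+d x_i\right)-\sum\limits_{1 \leq i, j \leq d+1}x_ix_j^{-1} \right) }{\left(1-\sum\limits_{i=1}^{d+1} x_i\right)\prod\limits_{i=1}^{d+1}(1-x_i)}. \end{equation*}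
   Context: A $d$-dimensional partition is an array $(\pi_{i_1,\ldots,i_d})$ of non-negative integers, all but finitely many zero, with $\pi_{\mathbf{i}}\ge \pi_{\mathbf{i}+e_k}$ for all $\mathbf{i}$ and $1\le k\le d$. It is identified with its Ferrers diagram $\lambda=\{(i_1,\ldots,i_d,k): 1\le k\le \pi_{i_1,\ldots,i_d}\}\subset \mathbb{N}_{>0}^{d+1}$; it is contained in an $(n_1,\ldots,n_{d+1})$-box if $\lambda\subseteq[n_1]\times\cdots\times[n_{d+1}]$. For $I\subseteq[d+1]$ let $\rho_I$ be the bijection of $[2n_1]\times\cdots\times[2n_{d+1}]$ sending $x_i\mapsto 2n_i+1-x_i$ for $i\in I$ and fixing the other coordinates. A partition is fully complementary inside a $(2n_1,\ldots,2n_{d+1})$-box if the sets $\rho_I(\lambda)$, $I\subseteq[d+1]$ of even size, are pairwise disjoint and their union is $[2n_1]\times\cdots\times[2n_{d+1}]$. Convention for the sum: if exactly one $n_{k}$ is $0$ and all others are positive, $\mathrm{FCP}(\mathbf{n})$ consists of a single "empty array" (count $1$); if two or more components of $\mathbf{n}$ are $0$, $\mathrm{FCP}(\mathbf{n})$ is empty (count $0$). *)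

theory Defs
  imports
    "HOL-Library.Poly_Mapping"
    "HOL-Library.FuncSet"
    "HOL-Library.Disjoint_Sets"
    "HOL-Computational_Algebra.Fraction_Field"
    "HOL-Computational_Algebra.Polynomial_Factorial"
begin

section \<open>Multivariate formal power series\<close>

text \<open>
  Formal power series in commuting variables \<open>X\<^sub>0, X\<^sub>1, \<dots>\<close> indexed by the natural numbers.
  A monomial is its exponent vector of type \<open>nat \<Rightarrow>\<^sub>0 nat\<close>. A series in finitely many
  variables is one whose coefficients vanish at all monomials involving another variable.
  Over an integral domain these series form an integral domain, so that \<open>x\<^sub>i\<^sup>-\<^sup>1\<close> and quotients of
  series make sense in its field of fractions.
\<close>

typedef 'a mfps = "UNIV :: ((nat \<Rightarrow>\<^sub>0 nat) \<Rightarrow> 'a) set"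
  morphisms mfps_nth Abs_mfps
  by simp

lemma mfps_nth_Abs_mfps [simp]: "mfps_nth (Abs_mfps f) m = f m"
  by (simp add: Abs_mfps_inverse)

lemma mfps_eqI: "(\<And>m. mfps_nth f m = mfps_nth g m) \<Longrightarrow> f = g"
  by (metis mfps_nth_inject ext)

lemma finite_bounded_monomials:
  assumes "finite A"
  shows "finite {m :: nat \<Rightarrow>\<^sub>0 nat. Poly_Mapping.keys m \<subseteq> A \<and> (\<forall>i. Poly_Mapping.lookup m i \<le> b)}"
    (is "finite ?M")
proof (rule finite_imageD)
  show "finite (Poly_Mapping.lookup ` ?M)"
    by (rule finite_subset[OF _ finite_set_of_finite_funs[OF assms, of "{..b}" 0]])
       (use assms in \<open>auto simp: in_keys_iff\<close>)
  show "inj_on Poly_Mapping.lookup ?M"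
    by (rule inj_onI) (simp add: poly_mapping_eqI)
qed

lemma finite_splits:
  "finite {(a, b). a + b = (m :: nat \<Rightarrow>\<^sub>0 nat)}"
proof -
  define B where "B = Max (insert 0 (Poly_Mapping.lookup m ` Poly_Mapping.keys m))"
  have B: "Poly_Mapping.lookup m i \<le> B" for i
    unfolding B_def by (cases "i \<in> Poly_Mapping.keys m") (auto simp: in_keys_iff)
  let ?S = "{a. Poly_Mapping.keys a \<subseteq> Poly_Mapping.keys m \<and> (\<forall>i. Poly_Mapping.lookup a i \<le> B)}"
  have "a \<in> ?S \<and> b \<in> ?S" if "a + b = m" for a b
  proof -
    have "Poly_Mapping.lookup m i = Poly_Mapping.lookup a i + Poly_Mapping.lookup b i" for i
      using that by (auto simp: lookup_add)
    moreover from this B have "Poly_Mapping.lookup a i \<le> B" "Poly_Mapping.lookup b i \<le> B" for i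
      by (metis le_add1 le_add2 le_trans)+
    ultimately show ?thesis by (auto simp: in_keys_iff)
  qed
  then have "{(a, b). a + b = m} \<subseteq> ?S \<times> ?S" by blast
  then show ?thesis
    by (rule finite_subset) (intro finite_cartesian_product finite_bounded_monomials finite_keys)
qed

lemmas finite_splits' = finite_splits[unfolded case_prod_unfold]

instantiation mfps :: (comm_ring_1) comm_ring_1
begin

definition "0 = Abs_mfps (\<lambda>_. 0)"
definition "1 = Abs_mfps (\<lambda>m. if m = 0 then 1 else 0)"
definition "f + g = Abs_mfps (\<lambda>m. mfps_nth f m + mfps_nth g m)"
definition "f - g = Abs_mfps (\<lambda>m. mfps_nth f m - mfps_nth g m)"
definition "- f = Abs_mfps (\<lambda>m. - mfps_nth f m)"
definition "f * g = Abs_mfps (\<lambda>m. \<Sum>(a, b) | a + b = m. mfps_nth f a * mfps_nth g b)"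

lemma mfps_zero_nth [simp]: "mfps_nth 0 m = 0"
  by (simp add: zero_mfps_def)

lemma mfps_one_nth [simp]: "mfps_nth 1 m = (if m = 0 then 1 else 0)"
  by (simp add: one_mfps_def)

lemma mfps_add_nth [simp]: "mfps_nth (f + g) m = mfps_nth f m + mfps_nth g m"
  by (simp add: plus_mfps_def)

lemma mfps_diff_nth [simp]: "mfps_nth (f - g) m = mfps_nth f m - mfps_nth g m"
  by (simp add: minus_mfps_def)

lemma mfps_uminus_nth [simp]: "mfps_nth (- f) m = - mfps_nth f m"
  by (simp add: uminus_mfps_def)

lemma mfps_mult_nth:
  "mfps_nth (f * g) m = (\<Sum>(a, b) | a + b = m. mfps_nth f a * mfps_nth g b)"
  by (simp add: times_mfps_def)

instance
proof
  fix f g h :: "'a mfps"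
  show "f * g * h = f * (g * h)"
  proof (rule mfps_eqI)
    fix m
    let ?c = "\<lambda>(a, b, c). mfps_nth f a * mfps_nth g b * mfps_nth h c"
    have "mfps_nth (f * g * h) m =
        (\<Sum>(p, c) | p + c = m. \<Sum>(a, b) | a + b = p. ?c (a, b, c))"
      by (simp add: mfps_mult_nth sum_distrib_right case_prod_unfold)
    also have "\<dots> = (\<Sum>(q, r) \<in> (SIGMA q:{(p, c). p + c = m}. {(a, b). a + b = fst q}).
        ?c (fst r, snd r, snd q))"
      by (subst sum.Sigma[symmetric]) (simp_all add: finite_splits' case_prod_unfold)
    also have "\<dots> = (\<Sum>(a, b, c) | a + b + c = m. ?c (a, b, c))"
      by (rule sum.reindex_bij_witness[where
            i = "\<lambda>(a, b, c). ((a + b, c), (a, b))" and j = "\<lambda>(q, r). (fst r, snd r, snd q)"]) auto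
    also have "\<dots> = (\<Sum>(q, r) \<in> (SIGMA q:{(a, p). a + p = m}. {(b, c). b + c = snd q}).
        ?c (fst q, fst r, snd r))"
      by (rule sum.reindex_bij_witness[where
            j = "\<lambda>(a, b, c). ((a, b + c), (b, c))" and i = "\<lambda>(q, r). (fst q, fst r, snd r)"])
         (auto simp: add.assoc)
    also have "\<dots> = (\<Sum>(a, p) | a + p = m. \<Sum>(b, c) | b + c = p. ?c (a, b, c))"
      by (subst sum.Sigma[symmetric]) (simp_all add: finite_splits' case_prod_unfold)
    also have "\<dots> = mfps_nth (f * (g * h)) m"
      by (simp add: mfps_mult_nth sum_distrib_left case_prod_unfold mult.assoc)
    finally show "mfps_nth (f * g * h) m = mfps_nth (f * (g * h)) m" .
  qed
  show "f * g = g * f"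
  proof (rule mfps_eqI)
    fix m
    show "mfps_nth (f * g) m = mfps_nth (g * f) m"
      unfolding mfps_mult_nth
      by (rule sum.reindex_bij_witness[where i = prod.swap and j = prod.swap])
         (auto simp: add.commute mult.commute)
  qed
  show "1 * f = f"
  proof (rule mfps_eqI)
    fix m
    have "mfps_nth (1 * f) m =
        (\<Sum>p \<in> {(a, b). a + b = m}. if p = (0, m) then mfps_nth f m else 0)"
      unfolding mfps_mult_nth by (rule sum.cong) (auto split: if_splits)
    then show "mfps_nth (1 * f) m = mfps_nth f m"
      by (simp add: finite_splits)
  qed
  show "(f + g) * h = f * h + g * h"
    by (rule mfps_eqI)
       (simp add: mfps_mult_nth case_prod_unfold distrib_right sum.distrib)
  have "mfps_nth (0 :: 'a mfps) 0 \<noteq> mfps_nth 1 0" by simp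
  then show "(0 :: 'a mfps) \<noteq> 1" by metis
qed (rule mfps_eqI; simp)+

end

lemma mfps_leading_monomial:
  fixes f :: "'a :: zero mfps"
  assumes "mfps_nth f w \<noteq> 0" "Poly_Mapping.keys w \<subseteq> {..<N}"
  defines "deg \<equiv> \<lambda>m :: nat \<Rightarrow>\<^sub>0 nat. \<Sum>i<N. Poly_Mapping.lookup m i"
  obtains m where "mfps_nth f m \<noteq> 0" "Poly_Mapping.keys m \<subseteq> {..<N}"
    "\<And>a. mfps_nth f a \<noteq> 0 \<Longrightarrow> Poly_Mapping.keys a \<subseteq> {..<N} \<Longrightarrow>
       deg m < deg a \<or> deg m = deg a \<and> m \<le> a"
proof -
  define S where "S = {m. mfps_nth f m \<noteq> 0 \<and> Poly_Mapping.keys m \<subseteq> {..<N}}"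
  define D where "D = (LEAST n. n \<in> deg ` S)"
  define T where "T = {m \<in> S. deg m = D}"
  have "w \<in> S" using assms by (simp add: S_def)
  then have "D \<in> deg ` S" unfolding D_def by (metis LeastI imageI)
  then have "T \<noteq> {}" by (auto simp: T_def)
  have le: "Poly_Mapping.lookup m i \<le> D" if "m \<in> T" for m i
  proof (cases "i < N")
    case True
    then have "Poly_Mapping.lookup m i \<le> deg m" unfolding deg_def by (intro member_le_sum) auto
    then show ?thesis using that by (simp add: T_def)
  next
    case False
    then have "i \<notin> Poly_Mapping.keys m" using that by (auto simp: T_def S_def)
    then show ?thesis by (simp add: in_keys_iff)
  qed
  have "finite T"
    by (rule finite_subset[OF _ finite_bounded_monomials[of "{..<N}" D]])
       (use le in \<open>auto simp: T_def S_def\<close>)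
  have D_le: "D \<le> deg a" if "a \<in> S" for a
    unfolding D_def using that by (auto intro: Least_le)
  have "Min T \<in> T" using \<open>finite T\<close> \<open>T \<noteq> {}\<close> by simp
  show thesis
  proof (rule that[of "Min T"])
    fix a assume "mfps_nth f a \<noteq> 0" "Poly_Mapping.keys a \<subseteq> {..<N}"
    then have "a \<in> S" by (simp add: S_def)
    show "deg (Min T) < deg a \<or> deg (Min T) = deg a \<and> Min T \<le> a"
    proof (cases "a \<in> T")
      case True
      then show ?thesis using \<open>Min T \<in> T\<close> \<open>finite T\<close> by (simp add: T_def)
    next
      case False
      then show ?thesis using \<open>Min T \<in> T\<close> \<open>a \<in> S\<close> D_le[of a] by (auto simp: T_def)
    qed
  qed (use \<open>Min T \<in> T\<close> in \<open>auto simp: T_def S_def\<close>)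
qed

instance mfps :: (idom) idom
proof
  fix f g :: "'a mfps"
  assume "f \<noteq> 0" "g \<noteq> 0"
  then obtain v w where vw: "mfps_nth f v \<noteq> 0" "mfps_nth g w \<noteq> 0"
    by (metis mfps_eqI mfps_zero_nth)
  define N where "N = Suc (Max (insert 0 (Poly_Mapping.keys v \<union> Poly_Mapping.keys w)))"
  have N: "Poly_Mapping.keys v \<subseteq> {..<N}" "Poly_Mapping.keys w \<subseteq> {..<N}"
    by (auto simp: N_def less_Suc_eq_le)
  let ?deg = "\<lambda>m :: nat \<Rightarrow>\<^sub>0 nat. \<Sum>i<N. Poly_Mapping.lookup m i"
  obtain p where p: "mfps_nth f p \<noteq> 0" "Poly_Mapping.keys p \<subseteq> {..<N}"
    "\<And>a. mfps_nth f a \<noteq> 0 \<Longrightarrow> Poly_Mapping.keys a \<subseteq> {..<N} \<Longrightarrow>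
       ?deg p < ?deg a \<or> ?deg p = ?deg a \<and> p \<le> a"
    using mfps_leading_monomial[OF vw(1) N(1)] by blast
  obtain q where q: "mfps_nth g q \<noteq> 0" "Poly_Mapping.keys q \<subseteq> {..<N}"
    "\<And>a. mfps_nth g a \<noteq> 0 \<Longrightarrow> Poly_Mapping.keys a \<subseteq> {..<N} \<Longrightarrow>
       ?deg q < ?deg a \<or> ?deg q = ?deg a \<and> q \<le> a"
    using mfps_leading_monomial[OF vw(2) N(2)] by blast
  have unique: "a = p \<and> b = q"
    if ab: "a + b = p + q" "mfps_nth f a \<noteq> 0" "mfps_nth g b \<noteq> 0" for a b
  proof -
    have eq: "Poly_Mapping.lookup a i + Poly_Mapping.lookup b i =
        Poly_Mapping.lookup p i + Poly_Mapping.lookup q i" for i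
      by (metis ab(1) lookup_add)
    have "i \<in> {..<N}" if "i \<in> Poly_Mapping.keys a \<union> Poly_Mapping.keys b" for i
      using that eq[of i] p(2) q(2) by (auto simp: in_keys_iff subset_eq)
    then have keys: "Poly_Mapping.keys a \<subseteq> {..<N}" "Poly_Mapping.keys b \<subseteq> {..<N}" by auto
    have "?deg a + ?deg b = ?deg p + ?deg q"
      by (simp add: sum.distrib[symmetric] eq)
    with p(3)[OF ab(2) keys(1)] q(3)[OF ab(3) keys(2)] have "p \<le> a" "q \<le> b"
      by linarith+
    then show ?thesis using ab(1)
      by (metis add.commute add_le_less_mono add_less_le_mono less_irrefl order_le_less)
  qed
  have "mfps_nth (f * g) (p + q) =
      (\<Sum>r \<in> {(a, b). a + b = p + q}. if r = (p, q) then mfps_nth f p * mfps_nth g q else 0)"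
    unfolding mfps_mult_nth
    by (rule sum.cong) (use unique in \<open>auto simp: case_prod_unfold\<close>)
  also have "\<dots> = mfps_nth f p * mfps_nth g q"
    by (simp add: finite_splits)
  finally have "mfps_nth (f * g) (p + q) \<noteq> 0" using p(1) q(1) by simp
  then show "f * g \<noteq> 0" by auto
qed

definition mfps_X :: "nat \<Rightarrow> 'a :: zero_neq_one mfps" where
  "mfps_X i = Abs_mfps (\<lambda>m. if m = Poly_Mapping.single i 1 then 1 else 0)"


section \<open>Fully complementary partitions\<close>

text \<open>
  A point of \<open>\<nat>\<^sup>k\<close> with positive coordinates is an extensional function on \<open>{1..k}\<close>, and an
  array is an extensional function on such points, so that equality of arrays is equality
  of their entries.
\<close>

definition pos_points :: "nat \<Rightarrow> (nat \<Rightarrow> nat) set" where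
  "pos_points k = (\<Pi>\<^sub>E i\<in>{1..k}. {1..})"

definition dim_partition :: "nat \<Rightarrow> ((nat \<Rightarrow> nat) \<Rightarrow> nat) \<Rightarrow> bool" where
  "dim_partition d \<pi> \<longleftrightarrow>
     \<pi> \<in> extensional (pos_points d) \<and>
     finite {i \<in> pos_points d. \<pi> i \<noteq> 0} \<and>
     (\<forall>i\<in>pos_points d. \<forall>k\<in>{1..d}. \<pi> (i(k := i k + 1)) \<le> \<pi> i)"

definition ferrers :: "nat \<Rightarrow> ((nat \<Rightarrow> nat) \<Rightarrow> nat) \<Rightarrow> (nat \<Rightarrow> nat) set" where
  "ferrers d \<pi> = {x \<in> pos_points (d + 1). x (d + 1) \<le> \<pi> (restrict x {1..d})}"

definition box :: "nat \<Rightarrow> (nat \<Rightarrow> nat) \<Rightarrow> (nat \<Rightarrow> nat) set" where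
  "box k m = (\<Pi>\<^sub>E i\<in>{1..k}. {1..m i})"

definition rho :: "(nat \<Rightarrow> nat) \<Rightarrow> nat set \<Rightarrow> (nat \<Rightarrow> nat) \<Rightarrow> (nat \<Rightarrow> nat)" where
  "rho n I x = (\<lambda>i. if i \<in> I then 2 * n i + 1 - x i else x i)"

text \<open>The box has side lengths \<open>2 n\<^sub>1, \<dots>, 2 n\<^sub>d\<^sub>+\<^sub>1\<close>.\<close>

definition fully_complementary ::
  "nat \<Rightarrow> (nat \<Rightarrow> nat) \<Rightarrow> ((nat \<Rightarrow> nat) \<Rightarrow> nat) \<Rightarrow> bool" where
  "fully_complementary d n \<pi> \<longleftrightarrow>
     (let B = box (d + 1) (\<lambda>i. 2 * n i);
          \<E> = {I. I \<subseteq> {1..d + 1} \<and> even (card I)}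
      in ferrers d \<pi> \<subseteq> B \<and>
         disjoint_family_on (\<lambda>I. rho n I ` ferrers d \<pi>) \<E> \<and>
         (\<Union>I\<in>\<E>. rho n I ` ferrers d \<pi>) = B)"

text \<open>
  By convention there are no fully complementary partitions if at least two of the \<open>n\<^sub>i\<close>
  vanish. If exactly one vanishes the box is empty and only the zero array remains, which is
  the ``empty array''; see \<open>FCP_one_zero\<close>.
\<close>

definition FCP :: "nat \<Rightarrow> (nat \<Rightarrow> nat) \<Rightarrow> ((nat \<Rightarrow> nat) \<Rightarrow> nat) set" where
  "FCP d n =
     (if card {i \<in> {1..d + 1}. n i = 0} \<ge> 2 then {}
      else {\<pi>. dim_partition d \<pi> \<and> fully_complementary d n \<pi>})"

lemma FCP_one_zero:
  assumes "card {i \<in> {1..d + 1}. n i = 0} = 1"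
  shows "FCP d n = {restrict (\<lambda>_. 0) (pos_points d)}"
proof -
  obtain j where j: "j \<in> {1..d + 1}" "n j = 0"
    using assms by (metis (mono_tags, lifting) card_1_singletonE mem_Collect_eq singletonI)
  have B: "box (d + 1) (\<lambda>i. 2 * n i) = {}"
    using j by (auto simp: box_def PiE_eq_empty_iff intro!: bexI[of _ j])
  have fe: "ferrers d \<pi> = {} \<longleftrightarrow> (\<forall>i\<in>pos_points d. \<pi> i = 0)" for \<pi>
  proof
    assume L: "ferrers d \<pi> = {}"
    show "\<forall>i\<in>pos_points d. \<pi> i = 0"
    proof (rule ccontr)
      assume "\<not> ?thesis"
      then obtain i where i: "i \<in> pos_points d" "\<pi> i \<ge> 1" by (auto simp: Suc_le_eq)
      then have r: "restrict (i(d + 1 := 1)) {1..d} = i"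
        by (auto simp: pos_points_def fun_eq_iff PiE_iff extensional_def)
      have "i(d + 1 := 1) \<in> pos_points (d + 1)"
        using i(1) by (auto simp: pos_points_def PiE_iff extensional_def)
      then have "i(d + 1 := 1) \<in> ferrers d \<pi>"
        using i(2) r by (simp add: ferrers_def)
      then show False using L by simp
    qed
  next
    assume R: "\<forall>i\<in>pos_points d. \<pi> i = 0"
    have "restrict x {1..d} \<in> pos_points d" "x (d + 1) \<ge> 1" if "x \<in> pos_points (d + 1)" for x
      using that by (auto simp: pos_points_def PiE_iff)
    then show "ferrers d \<pi> = {}" using R by (fastforce simp: ferrers_def)
  qed
  have up: "i(k := Suc (i k)) \<in> pos_points d" if "i \<in> pos_points d" "k \<in> {1..d}" for i k
    using that by (auto simp: pos_points_def PiE_iff extensional_def)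
  have "dim_partition d \<pi> \<and> fully_complementary d n \<pi> \<longleftrightarrow> \<pi> = restrict (\<lambda>_. 0) (pos_points d)"
    for \<pi>
  proof
    assume "dim_partition d \<pi> \<and> fully_complementary d n \<pi>"
    then have "\<pi> \<in> extensional (pos_points d)" "\<forall>i\<in>pos_points d. \<pi> i = 0"
      using B fe[of \<pi>] by (auto simp: dim_partition_def fully_complementary_def Let_def)
    then show "\<pi> = restrict (\<lambda>_. 0) (pos_points d)"
      by (auto simp: fun_eq_iff extensional_def)
  next
    assume \<pi>: "\<pi> = restrict (\<lambda>_. 0) (pos_points d)"
    then have "ferrers d \<pi> = {}" by (simp add: fe)
    then have "fully_complementary d n \<pi>"
      by (simp only: fully_complementary_def B Let_def) (simp add: disjoint_family_on_def)
    moreover have "dim_partition d \<pi>"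
      using up by (auto simp: dim_partition_def \<pi>)
    ultimately show "dim_partition d \<pi> \<and> fully_complementary d n \<pi>" by simp
  qed
  then show ?thesis using assms by (auto simp: FCP_def)
qed

text \<open>
  The series \<open>\<Sum>\<^sub>n |FCP(n)| x\<^sup>n\<close> over \<open>n \<in> \<nat>\<^sup>d\<^sup>+\<^sup>1\<close>, in the variables \<open>X\<^sub>1, \<dots>, X\<^sub>d\<^sub>+\<^sub>1\<close>. The guard on
  \<open>keys\<close> discards the monomials that involve other variables.
\<close>

definition FCP_series :: "nat \<Rightarrow> int mfps" where
  "FCP_series d =
     Abs_mfps (\<lambda>n.
       if Poly_Mapping.keys n \<subseteq> {1..d + 1} then int (card (FCP d (Poly_Mapping.lookup n)))
       else 0)"

end

theory Submission
  imports Defs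
begin

text \<open>
  A fully complementary diagram in the box with sides \<open>2 n\<^sub>i\<close> contains the whole small box \<open>[n]\<close>
  and, for each \<open>x \<in> [n]\<close>, exactly one point obtained from \<open>x\<close> by reflecting an odd number of
  coordinates; that number must be one, for a point with three reflected coordinates would force
  into the diagram a second point reflected in an even number of coordinates. The
  diagram is thus a colouring \<open>f\<close> of \<open>[n]\<close> by directions, and being a down-set means that \<open>f x = i\<close>
  propagates to all \<open>y\<close> with \<open>y\<^sub>i \<ge> x\<^sub>i\<close> and \<open>y\<^sub>j \<le> x\<^sub>j\<close> for \<open>j \<noteq> i\<close>. The colour \<open>i\<close> of the corner \<open>n\<close>
  therefore fills the slice \<open>x\<^sub>i = n\<^sub>i\<close>, and what remains is an arbitrary colouring of
  \<open>[n - e\<^sub>i]\<close>. Hence the number of partitions is the sum of its values at \<open>n - e\<^sub>i\<close> over all \<open>i\<close>,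
  with boundary value \<open>1\<close> where exactly one \<open>n\<^sub>i\<close> vanishes.
\<close>

section \<open>Partitions and down-sets\<close>

definition downset :: "nat \<Rightarrow> (nat \<Rightarrow> nat) set \<Rightarrow> bool" where
  "downset k L \<longleftrightarrow>
     L \<subseteq> pos_points k \<and>
     (\<forall>x\<in>L. \<forall>y\<in>pos_points k. (\<forall>i\<in>{1..k}. y i \<le> x i) \<longrightarrow> y \<in> L)"

lemma downsetD:
  "\<lbrakk>downset k L; x \<in> L; y \<in> pos_points k; \<And>i. i \<in> {1..k} \<Longrightarrow> y i \<le> x i\<rbrakk> \<Longrightarrow> y \<in> L"
  by (auto simp: downset_def)

text \<open>Any smaller point is reached by unit decrements, so induction on the total gap works.
  Partitions give monotonicity only for unit steps, hence this criterion.\<close>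

lemma downset_if_step_closed:
  assumes "L \<subseteq> pos_points k"
    and step: "\<And>x j. \<lbrakk>x \<in> pos_points k; j \<in> {1..k}; x(j := x j + 1) \<in> L\<rbrakk> \<Longrightarrow> x \<in> L"
  shows "downset k L"
proof -
  have "y \<in> L" if "x \<in> L" "y \<in> pos_points k" "\<forall>i\<in>{1..k}. y i \<le> x i" for x y
    using that(2,3)
  proof (induction "\<Sum>i\<in>{1..k}. x i - y i" arbitrary: y rule: less_induct)
    case less
    show ?case
    proof (cases "\<exists>j\<in>{1..k}. y j < x j")
      case False
      have "y = x"
      proof (rule extensionalityI)
        show "y \<in> extensional {1..k}" "x \<in> extensional {1..k}"
          using less.prems(1) \<open>x \<in> L\<close> assms(1) by (auto simp: pos_points_def PiE_iff)
        show "y i = x i" if "i \<in> {1..k}" for i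
          using False less.prems(2) that by (metis le_neq_implies_less)
      qed
      then show ?thesis using \<open>x \<in> L\<close> by simp
    next
      case True
      then obtain j where j: "j \<in> {1..k}" "y j < x j" by blast
      let ?y = "y(j := y j + 1)"
      have "?y \<in> L"
      proof (rule less.hyps)
        show "(\<Sum>i\<in>{1..k}. x i - ?y i) < (\<Sum>i\<in>{1..k}. x i - y i)"
          using j by (intro sum_strict_mono_ex1) auto
        show "?y \<in> pos_points k"
          using less.prems(1) j by (auto simp: pos_points_def PiE_iff extensional_def)
      qed (use less.prems(2) j in auto)
      then show ?thesis using step less.prems(1) j(1) by blast
    qed
  qed
  then show ?thesis using assms(1) by (auto simp: downset_def)
qed

section \<open>Tilings of the box by even reflections\<close>

definition complementary_diagrams :: "nat \<Rightarrow> (nat \<Rightarrow> nat) \<Rightarrow> (nat \<Rightarrow> nat) set set" where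
  "complementary_diagrams k n =
     {L. downset k L \<and> L \<subseteq> box k (\<lambda>i. 2 * n i) \<and>
         (\<forall>z\<in>box k (\<lambda>i. 2 * n i). \<exists>!I. I \<subseteq> {1..k} \<and> even (card I) \<and> rho n I z \<in> L)}"

lemma box_subset_pos_points: "box k m \<subseteq> pos_points k"
  by (auto simp: box_def pos_points_def PiE_iff)

lemma rho_in_box:
  assumes "x \<in> box k (\<lambda>i. 2 * n i)" "I \<subseteq> {1..k}"
  shows "rho n I x \<in> box k (\<lambda>i. 2 * n i)"
proof -
  have "1 \<le> rho n I x i \<and> rho n I x i \<le> 2 * n i" if "i \<in> {1..k}" for i
    using assms(1) that by (auto simp: box_def rho_def PiE_iff dest!: bspec[of _ _ i])
  moreover have "rho n I x i = undefined" if "i \<notin> {1..k}" for i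
    using assms that by (auto simp: box_def rho_def PiE_iff extensional_def)
  ultimately show ?thesis by (auto simp: box_def PiE_iff extensional_def)
qed

text \<open>Two flips of the same coordinate cancel, so reflections compose by symmetric
  difference.\<close>

lemma rho_rho:
  assumes "x \<in> box k (\<lambda>i. 2 * n i)" "I \<subseteq> {1..k}"
  shows "rho n J (rho n I x) = rho n (sym_diff I J) x"
proof
  fix i
  \<comment> \<open>The bound keeps \<open>2 * n i + 1 - x i\<close> free of truncation, so that
    flipping twice gives back \<open>x i\<close>.\<close>
  have "x i \<le> 2 * n i" if "i \<in> I" using assms that by (auto simp: box_def PiE_iff)
  then show "rho n J (rho n I x) i = rho n (sym_diff I J) x i"
    by (auto simp: rho_def)
qed

lemma rho_empty [simp]: "rho n {} x = x"
  by (simp add: rho_def)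

lemma even_card_sym_diff:
  assumes "finite I" "finite J"
  shows "even (card (sym_diff I J)) \<longleftrightarrow> even (card I + card J)"
proof -
  have "card (sym_diff I J) = card (I - J) + card (J - I)"
    using assms by (intro card_Un_disjoint) auto
  moreover have "card I = card (I - J) + card (I \<inter> J)" "card J = card (J - I) + card (I \<inter> J)"
    using assms by (metis card_Int_Diff Int_commute add.commute)+
  ultimately show ?thesis by presburger
qed

lemma partition_iff_ex1:
  "disjoint_family_on A \<E> \<and> (\<Union>I\<in>\<E>. A I) = B \<longleftrightarrow>
     (\<forall>I\<in>\<E>. A I \<subseteq> B) \<and> (\<forall>z\<in>B. \<exists>!I. I \<in> \<E> \<and> z \<in> A I)"
  unfolding disjoint_family_on_def disjoint_iff by fast

text \<open>Each \<open>rho n I\<close> is an involution of the box, so the tile containing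
  \<open>z\<close> is found by reflecting \<open>z\<close> instead of \<open>L\<close>. Disjointness
  and covering become one condition on points, the form used in
  \<open>complementary_diagrams\<close>.\<close>

lemma tiling_iff_unique_rho:
  assumes "L \<subseteq> box k (\<lambda>i. 2 * n i)"
  defines "\<E> \<equiv> {I. I \<subseteq> {1..k} \<and> even (card I)}"
  shows "disjoint_family_on (\<lambda>I. rho n I ` L) \<E> \<and> (\<Union>I\<in>\<E>. rho n I ` L) = box k (\<lambda>i. 2 * n i) \<longleftrightarrow>
     (\<forall>z\<in>box k (\<lambda>i. 2 * n i). \<exists>!I. I \<subseteq> {1..k} \<and> even (card I) \<and> rho n I z \<in> L)"
    (is "?lhs \<longleftrightarrow> ?rhs")
proof -
  have mem: "z \<in> rho n I ` L \<longleftrightarrow> z \<in> box k (\<lambda>i. 2 * n i) \<and> rho n I z \<in> L" if "I \<in> \<E>" for I z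
  proof -
    have I: "I \<subseteq> {1..k}" using that by (simp add: \<E>_def)
    have "rho n I (rho n I w) = w" if "w \<in> box k (\<lambda>i. 2 * n i)" for w
      using rho_rho[OF that I, of I] by simp
    then show ?thesis using assms(1) rho_in_box[OF _ I, of _ n]
      by (auto simp: image_iff subset_eq) (metis)
  qed
  have "(\<forall>I\<in>\<E>. rho n I ` L \<subseteq> box k (\<lambda>i. 2 * n i)) \<and>
      (\<forall>z\<in>box k (\<lambda>i. 2 * n i). \<exists>!I. I \<in> \<E> \<and> z \<in> rho n I ` L) \<longleftrightarrow>
      (\<forall>z\<in>box k (\<lambda>i. 2 * n i). \<exists>!I. I \<in> \<E> \<and> rho n I z \<in> L)"
    by (simp add: mem subset_eq cong: conj_cong)
  then show ?thesis
    unfolding partition_iff_ex1 by (simp add: \<E>_def conj_assoc)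
qed

section \<open>Arrays and the columns of their Ferrers diagrams\<close>

lemma finite_nat_downset_eq:
  fixes T :: "nat set"
  assumes "finite T" "0 \<notin> T" "\<And>s t. \<lbrakk>t \<in> T; 1 \<le> s; s \<le> t\<rbrakk> \<Longrightarrow> s \<in> T"
  shows "T = {1..card T}"
proof (cases "T = {}")
  case False
  have "T = {1..Max T}"
    using assms(3)[OF Max_in[OF assms(1) False]] assms(1,2)
    by (auto simp: Suc_le_eq intro: gr0I)
  then show ?thesis by (metis card_atLeastAtMost diff_Suc_1)
qed simp

text \<open>Writing a point as \<open>i(d + 1 := t)\<close> removes the restriction in
  \<open>ferrers\<close> and lets diagrams be compared column by column.\<close>

lemma mem_ferrers_iff:
  assumes "i \<in> pos_points d" "t \<ge> 1"
  shows "i(d + 1 := t) \<in> ferrers d \<pi> \<longleftrightarrow> t \<le> \<pi> i"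
proof -
  have "restrict (i(d + 1 := t)) {1..d} = i"
    using assms by (auto simp: pos_points_def fun_eq_iff PiE_iff extensional_def)
  moreover have "i(d + 1 := t) \<in> pos_points (d + 1)"
    using assms by (auto simp: pos_points_def PiE_iff extensional_def)
  ultimately show ?thesis by (simp add: ferrers_def)
qed

lemma pos_points_SucE:
  assumes "x \<in> pos_points (d + 1)"
  obtains i t where "i \<in> pos_points d" "t \<ge> 1" "x = i(d + 1 := t)"
proof (rule that)
  show "restrict x {1..d} \<in> pos_points d" "x (d + 1) \<ge> 1"
    using assms by (auto simp: pos_points_def PiE_iff)
  show "x = (restrict x {1..d})(d + 1 := x (d + 1))"
    using assms by (auto simp: pos_points_def PiE_iff extensional_def fun_eq_iff)
qed

lemma pos_points_fun_upd:
  "\<lbrakk>x \<in> pos_points k; j \<in> {1..k}; t \<ge> 1\<rbrakk> \<Longrightarrow> x(j := t) \<in> pos_points k"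
  by (auto simp: pos_points_def PiE_iff extensional_def)

lemma downset_ferrers:
  assumes "dim_partition d \<pi>"
  shows "downset (d + 1) (ferrers d \<pi>)"
proof (rule downset_if_step_closed)
  show "ferrers d \<pi> \<subseteq> pos_points (d + 1)" by (auto simp: ferrers_def)
next
  fix x j
  assume x: "x \<in> pos_points (d + 1)" and j: "j \<in> {1..d + 1}"
    and mem: "x(j := x j + 1) \<in> ferrers d \<pi>"
  from x obtain i t where it: "i \<in> pos_points d" "t \<ge> 1" "x = i(d + 1 := t)"
    by (rule pos_points_SucE)
  show "x \<in> ferrers d \<pi>"
  proof (cases "j = d + 1")
    case True
    then show ?thesis using mem it mem_ferrers_iff[of i d "t + 1" \<pi>] mem_ferrers_iff[of i d t \<pi>]
      by simp
  next
    case False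
    then have j': "j \<in> {1..d}" using j by auto
    then have "x(j := x j + 1) = (i(j := i j + 1))(d + 1 := t)"
      using it False by (auto simp: fun_eq_iff)
    moreover have "i(j := i j + 1) \<in> pos_points d"
      using it(1) j' by (intro pos_points_fun_upd) auto
    ultimately have "t \<le> \<pi> (i(j := i j + 1))"
      using mem it(2) mem_ferrers_iff by metis
    also have "\<dots> \<le> \<pi> i"
      using assms it(1) j' by (auto simp: dim_partition_def)
    finally show ?thesis using it mem_ferrers_iff by metis
  qed
qed

lemma fully_complementary_iff:
  assumes "dim_partition d \<pi>"
  shows "fully_complementary d n \<pi> \<longleftrightarrow> ferrers d \<pi> \<in> complementary_diagrams (d + 1) n"
proof (cases "ferrers d \<pi> \<subseteq> box (d + 1) (\<lambda>i. 2 * n i)")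
  case True
  then show ?thesis
    by (simp only: fully_complementary_def complementary_diagrams_def Let_def mem_Collect_eq
        tiling_iff_unique_rho downset_ferrers[OF assms] simp_thms)
qed (simp add: fully_complementary_def complementary_diagrams_def Let_def)

lemma inj_on_ferrers: "inj_on (ferrers d) {\<pi>. dim_partition d \<pi>}"
proof (rule inj_onI, clarify)
  fix \<pi> \<sigma>
  assume p: "dim_partition d \<pi>" "dim_partition d \<sigma>" and eq: "ferrers d \<pi> = ferrers d \<sigma>"
  show "\<pi> = \<sigma>"
  proof (rule extensionalityI)
    show "\<pi> \<in> extensional (pos_points d)" "\<sigma> \<in> extensional (pos_points d)"
      using p by (auto simp: dim_partition_def)
  next
    fix i assume i: "i \<in> pos_points d"
    have "t \<le> \<pi> i \<longleftrightarrow> t \<le> \<sigma> i" for t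
      using mem_ferrers_iff[OF i, of t \<pi>] mem_ferrers_iff[OF i, of t \<sigma>] eq
      by (cases "t = 0") auto
    then show "\<pi> i = \<sigma> i" by (metis order.refl order.antisym)
  qed
qed

text \<open>The array is recovered as the column heights of \<open>L\<close>. Down-closure makes
  each column an initial segment, so its cardinality determines it; the enclosing box bounds the
  columns and the support.\<close>

lemma ferrers_surj:
  assumes down: "downset (d + 1) L" and L: "L \<subseteq> box (d + 1) m"
  obtains \<pi> where "dim_partition d \<pi>" "ferrers d \<pi> = L"
proof
  define T where "T i = {t. t \<ge> 1 \<and> i(d + 1 := t) \<in> L}" for i
  define \<pi> where "\<pi> = (\<lambda>i\<in>pos_points d. card (T i))"
  have T_sub: "T i \<subseteq> {1..m (d + 1)}" for i
  proof
    fix t assume "t \<in> T i"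
    then have "t \<ge> 1" "i(d + 1 := t) \<in> box (d + 1) m" using L by (auto simp: T_def)
    then show "t \<in> {1..m (d + 1)}"
      by (auto simp: box_def PiE_iff dest!: bspec[of _ _ "d + 1"])
  qed
  have T: "T i = {1..\<pi> i}" if i: "i \<in> pos_points d" for i
  proof -
    have "T i = {1..card (T i)}"
    proof (rule finite_nat_downset_eq)
      show "finite (T i)" using T_sub finite_subset by blast
      show "0 \<notin> T i" by (simp add: T_def)
      fix s t assume t: "t \<in> T i" "1 \<le> s" "s \<le> t"
      have "i(d + 1 := s) \<in> L"
      proof (rule downsetD[OF down])
        show "i(d + 1 := t) \<in> L" using t by (simp add: T_def)
        show "i(d + 1 := s) \<in> pos_points (d + 1)"
          using i t by (auto simp: pos_points_def PiE_iff extensional_def)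
      qed (use t in auto)
      then show "s \<in> T i" using t by (simp add: T_def)
    qed
    then show ?thesis using i by (simp add: \<pi>_def)
  qed
  have mem: "i(d + 1 := t) \<in> L \<longleftrightarrow> t \<le> \<pi> i" if "i \<in> pos_points d" "t \<ge> 1" for i t
    using T[OF that(1)] that by (auto simp: T_def set_eq_iff)
  show "ferrers d \<pi> = L"
  proof (rule set_eqI)
    fix x
    show "x \<in> ferrers d \<pi> \<longleftrightarrow> x \<in> L"
    proof (cases "x \<in> pos_points (d + 1)")
      case True
      then obtain i t where "i \<in> pos_points d" "t \<ge> 1" "x = i(d + 1 := t)"
        by (rule pos_points_SucE)
      then show ?thesis by (simp only: mem mem_ferrers_iff)
    next
      case False
      then show ?thesis using down by (auto simp: ferrers_def downset_def)
    qed
  qed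
  show "dim_partition d \<pi>"
    unfolding dim_partition_def
  proof (intro conjI ballI)
    show "\<pi> \<in> extensional (pos_points d)" by (simp add: \<pi>_def)
    have "i \<in> box d m" if i: "i \<in> pos_points d" "\<pi> i \<noteq> 0" for i
    proof -
      \<comment> \<open>A nonzero entry puts the bottom point of its column into \<open>L\<close>,
        hence into the box, which confines \<open>i\<close>.\<close>
      have "i(d + 1 := 1) \<in> box (d + 1) m" using mem[of i 1] i L by auto
      then have "i j \<le> m j" if "j \<in> {1..d}" for j
        using that by (auto simp: box_def PiE_iff dest!: bspec[of _ _ j])
      then show ?thesis using i(1) by (auto simp: box_def pos_points_def PiE_iff)
    qed
    then have "{i \<in> pos_points d. \<pi> i \<noteq> 0} \<subseteq> box d m" by auto
    moreover have "finite (box d m)" by (auto simp: box_def intro: finite_PiE)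
    ultimately show "finite {i \<in> pos_points d. \<pi> i \<noteq> 0}" by (rule finite_subset)
  next
    fix i k assume i: "i \<in> pos_points d" and k: "k \<in> {1..d}"
    let ?i = "i(k := i k + 1)" let ?t = "\<pi> ?i"
    have i': "?i \<in> pos_points d" using i k by (intro pos_points_fun_upd) auto
    show "?t \<le> \<pi> i"
    proof (cases "?t = 0")
      case False
      then have "?i(d + 1 := ?t) \<in> L" using mem[OF i', of ?t] by simp
      then have "i(d + 1 := ?t) \<in> L"
      proof (rule downsetD[OF down])
        show "i(d + 1 := ?t) \<in> pos_points (d + 1)"
          using i False by (auto simp: pos_points_def PiE_iff extensional_def)
      qed auto
      then show ?thesis using mem[OF i, of ?t] False by simp
    qed simp
  qed
qed

lemma card_FCP_eq_diagrams:
  assumes "\<And>i. i \<in> {1..d + 1} \<Longrightarrow> n i > 0"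
  shows "card (FCP d n) = card (complementary_diagrams (d + 1) n)"
proof -
  have "{i \<in> {1..d + 1}. n i = 0} = {}" using assms by fastforce
  then have FCP: "FCP d n = {\<pi>. dim_partition d \<pi> \<and> fully_complementary d n \<pi>}"
    unfolding FCP_def by (metis card.empty not_numeral_le_zero)
  have "ferrers d ` FCP d n = complementary_diagrams (d + 1) n"
  proof (intro equalityI subsetI)
    fix L assume "L \<in> ferrers d ` FCP d n"
    then show "L \<in> complementary_diagrams (d + 1) n" using fully_complementary_iff FCP by auto
  next
    fix L assume L: "L \<in> complementary_diagrams (d + 1) n"
    then have "downset (d + 1) L" "L \<subseteq> box (d + 1) (\<lambda>i. 2 * n i)"
      unfolding complementary_diagrams_def by blast+
    then obtain \<pi> where \<pi>: "dim_partition d \<pi>" "ferrers d \<pi> = L" by (rule ferrers_surj)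
    then show "L \<in> ferrers d ` FCP d n" using L fully_complementary_iff[OF \<pi>(1)] FCP by auto
  qed
  moreover have "inj_on (ferrers d) (FCP d n)"
    by (rule inj_on_subset[OF inj_on_ferrers]) (auto simp: FCP)
  ultimately show ?thesis by (metis card_image)
qed


section \<open>Down-sets and colourings of the small box\<close>

text \<open>\<open>f x = i\<close> stands for the reflection of \<open>x\<close> in direction
  \<open>i\<close> lying in the diagram. Reflecting coordinate \<open>i\<close> reverses its order,
  so the premise says that the reflected \<open>y\<close> lies below the reflected \<open>x\<close>:
  this is down-closure read on the small box.\<close>

definition colourings :: "nat \<Rightarrow> (nat \<Rightarrow> nat) \<Rightarrow> ((nat \<Rightarrow> nat) \<Rightarrow> nat) set" where
  "colourings k n =
     {f \<in> box k n \<rightarrow>\<^sub>E {1..k}. \<forall>x\<in>box k n. \<forall>y\<in>box k n.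
        x (f x) \<le> y (f x) \<and> (\<forall>j\<in>{1..k} - {f x}. y j \<le> x j) \<longrightarrow> f y = f x}"

definition colouring_diagram ::
  "nat \<Rightarrow> (nat \<Rightarrow> nat) \<Rightarrow> ((nat \<Rightarrow> nat) \<Rightarrow> nat) \<Rightarrow> (nat \<Rightarrow> nat) set" where
  "colouring_diagram k n f = box k n \<union> (\<lambda>x. rho n {f x} x) ` box k n"

section \<open>From colourings to diagrams\<close>

lemma box_subset_double_box: "box k n \<subseteq> box k (\<lambda>i. 2 * n i)"
  by (force simp: box_def PiE_iff)

lemma colouringsD:
  "\<lbrakk>f \<in> colourings k n; x \<in> box k n; y \<in> box k n; x (f x) \<le> y (f x);
    \<And>j. \<lbrakk>j \<in> {1..k}; j \<noteq> f x\<rbrakk> \<Longrightarrow> y j \<le> x j\<rbrakk> \<Longrightarrow> f y = f x"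
  unfolding colourings_def by blast

lemma colourings_PiE: "f \<in> colourings k n \<Longrightarrow> f \<in> box k n \<rightarrow>\<^sub>E {1..k}"
  unfolding colourings_def by blast

lemma colourings_range: "\<lbrakk>f \<in> colourings k n; x \<in> box k n\<rbrakk> \<Longrightarrow> f x \<in> {1..k}"
  by (drule colourings_PiE) auto

text \<open>Coordinates of the small box are at most \<open>n i\<close> and reflected ones exceed
  \<open>n i\<close>, so the set of reflected coordinates, and then the point, can be read
  off.\<close>

lemma rho_inj:
  assumes "x \<in> box k n" "y \<in> box k n" "I \<subseteq> {1..k}" "J \<subseteq> {1..k}" "rho n I x = rho n J y"
  shows "I = J" "x = y"
proof -
  have bnd: "1 \<le> x i" "x i \<le> n i" "1 \<le> y i" "y i \<le> n i" if "i \<in> {1..k}" for i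
    using assms(1,2) that by (auto simp: box_def PiE_iff)
  have eq: "(if i \<in> I then 2 * n i + 1 - x i else x i) = (if i \<in> J then 2 * n i + 1 - y i else y i)"
    for i using fun_cong[OF assms(5), of i] by (simp add: rho_def)
  have "(i \<in> I \<longleftrightarrow> i \<in> J) \<and> x i = y i" if "i \<in> {1..k}" for i
    using bnd[OF that] eq[of i] by (auto split: if_splits)
  moreover have "(i \<in> I \<longleftrightarrow> i \<in> J) \<and> x i = y i" if "i \<notin> {1..k}" for i
    using assms(1-4) that by (auto simp: box_def PiE_iff extensional_def)
  ultimately show "I = J" "x = y" by (blast, auto)
qed

text \<open>Reflect exactly the coordinates beyond the middle. With \<open>rho_inj\<close>, every
  point of the double box has a unique form \<open>rho n J x\<close> with \<open>x\<close> in the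
  small box.\<close>

lemma folding:
  assumes "z \<in> box k (\<lambda>i. 2 * n i)"
  obtains x J where "x \<in> box k n" "J \<subseteq> {1..k}" "z = rho n J x" "x = rho n J z"
proof -
  let ?J = "{i \<in> {1..k}. z i > n i}"
  have "rho n ?J z \<in> box k n"
    using assms by (fastforce simp: box_def rho_def PiE_iff extensional_def)
  moreover have "rho n ?J (rho n ?J z) = z" by (subst rho_rho[OF assms]) auto
  ultimately show thesis by (intro that[of "rho n ?J z" ?J]) auto
qed

lemma mem_colouring_diagram:
  assumes f: "f \<in> colourings k n" and x: "x \<in> box k n" and I: "I \<subseteq> {1..k}"
  shows "rho n I x \<in> colouring_diagram k n f \<longleftrightarrow> I = {} \<or> I = {f x}"
proof
  assume "rho n I x \<in> colouring_diagram k n f"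
  then consider "rho n I x \<in> box k n" | y where "y \<in> box k n" "rho n I x = rho n {f y} y"
    by (auto simp: colouring_diagram_def)
  then show "I = {} \<or> I = {f x}"
  proof cases
    case 1
    then show ?thesis using rho_inj[OF x _ I, of "rho n I x" "{}"] by simp
  next
    case 2
    then show ?thesis
      using rho_inj[OF x 2(1) I, of "{f y}"] colourings_range[OF f 2(1)] by auto
  qed
qed (use x in \<open>auto simp: colouring_diagram_def\<close>)

text \<open>Below a reflected point of colour \<open>i\<close> only coordinate \<open>i\<close> can
  leave the small box. If it does, reflecting back gives a point to which the colour
  \<open>i\<close> propagates.\<close>

lemma downset_colouring_diagram:
  assumes f: "f \<in> colourings k n"
  shows "downset k (colouring_diagram k n f)"
  unfolding downset_def
proof (intro conjI ballI impI)
  have "rho n {f x} x \<in> box k (\<lambda>i. 2 * n i)" if "x \<in> box k n" for x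
    using that box_subset_double_box colourings_range[OF f that] by (intro rho_in_box) auto
  then show "colouring_diagram k n f \<subseteq> pos_points k"
    using box_subset_pos_points by (fastforce simp: colouring_diagram_def)
next
  fix z y
  assume z: "z \<in> colouring_diagram k n f" and y: "y \<in> pos_points k" and le: "\<forall>i\<in>{1..k}. y i \<le> z i"
  have y_box: "y \<in> box k n" if "\<And>i. i \<in> {1..k} \<Longrightarrow> y i \<le> n i"
    using that y by (auto simp: box_def pos_points_def PiE_iff)
  from z consider "z \<in> box k n" | x where "x \<in> box k n" "z = rho n {f x} x"
    by (auto simp: colouring_diagram_def)
  then show "y \<in> colouring_diagram k n f"
  proof cases
    case 1
    then have "z i \<le> n i" if "i \<in> {1..k}" for i using that by (auto simp: box_def)
    then have "y \<in> box k n" using le y_box order_trans by blast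
    then show ?thesis by (simp add: colouring_diagram_def)
  next
    case 2
    let ?i = "f x"
    have i: "?i \<in> {1..k}" using colourings_range[OF f 2(1)] .
    have x: "1 \<le> x j" "x j \<le> n j" if "j \<in> {1..k}" for j using 2(1) that by (auto simp: box_def)
    have le': "y j \<le> x j" if "j \<in> {1..k}" "j \<noteq> ?i" for j
      using le that 2(2) by (auto simp: rho_def dest!: bspec[of _ _ j])
    have lei: "y ?i \<le> 2 * n ?i + 1 - x ?i" using bspec[OF le i] 2(2) by (simp add: rho_def)
    show ?thesis
    proof (cases "y ?i \<le> n ?i")
      case True
      have "y j \<le> n j" if "j \<in> {1..k}" for j
        using True le'[OF that] x[OF that] by (cases "j = ?i") auto
      then show ?thesis using y_box by (simp add: colouring_diagram_def)
    next
      case False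
      have y2: "y \<in> box k (\<lambda>i. 2 * n i)"
      proof -
        have "y j \<le> 2 * n j" if "j \<in> {1..k}" for j
          using lei le'[OF that] x[OF that] by (cases "j = ?i") auto
        then show ?thesis using y by (auto simp: box_def pos_points_def PiE_iff)
      qed
      let ?y = "rho n {?i} y"
      have yb: "?y \<in> box k n"
      proof -
        have "1 \<le> ?y j \<and> ?y j \<le> n j" if "j \<in> {1..k}" for j
          using lei le'[OF that] x[OF that] False y that
          by (cases "j = ?i") (auto simp: rho_def pos_points_def)
        then show ?thesis
          using y i by (auto simp: box_def pos_points_def PiE_iff rho_def extensional_def)
      qed
      \<comment> \<open>Reflection turns the bound \<open>lei\<close> into
        \<open>x ?i \<le> ?y ?i\<close>, while the other coordinates stay below those of
        \<open>x\<close>: exactly the propagation condition.\<close>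
      have "f ?y = ?i"
        by (rule colouringsD[OF f 2(1) yb])
          (use lei x[OF i] False le' in \<open>auto simp: rho_def\<close>)
      then have "rho n {f ?y} ?y = y" using rho_rho[OF y2, of "{?i}" "{?i}"] i by simp
      then have "y \<in> (\<lambda>x. rho n {f x} x) ` box k n" using yb by (intro image_eqI[OF sym])
      then show ?thesis unfolding colouring_diagram_def by (rule UnI2)
    qed
  qed
qed

lemma sym_diff_eq_iff: "sym_diff I J = K \<longleftrightarrow> J = sym_diff I K"
  by blast

lemma sym_diff_cancel: "sym_diff I (sym_diff I J) = J"
  by blast

text \<open>If \<open>z = rho n J x\<close>, only \<open>J\<close> and its symmetric difference with
  \<open>{f x}\<close> bring \<open>z\<close> into the diagram. The two differ by one element, so
  exactly one has even size.\<close>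

lemma colouring_diagram_complementary:
  assumes f: "f \<in> colourings k n"
  shows "colouring_diagram k n f \<in> complementary_diagrams k n"
proof -
  have "\<exists>!I. I \<subseteq> {1..k} \<and> even (card I) \<and> rho n I z \<in> colouring_diagram k n f"
    if z: "z \<in> box k (\<lambda>i. 2 * n i)" for z
  proof -
    obtain x J where x: "x \<in> box k n" "J \<subseteq> {1..k}" "z = rho n J x"
      using folding[OF z] by metis
    have i: "f x \<in> {1..k}" using colourings_range[OF f x(1)] .
    have fin: "finite J" using x(2) by (rule finite_subset) simp
    have mem: "rho n I z \<in> colouring_diagram k n f \<longleftrightarrow> I = J \<or> I = sym_diff J {f x}"
      if "I \<subseteq> {1..k}" for I
    proof -
      have "rho n I z = rho n (sym_diff J I) x"
        using rho_rho[OF subsetD[OF box_subset_double_box x(1)] x(2)] x(3) by simp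
      moreover have "sym_diff J I \<subseteq> {1..k}" using that x(2) by blast
      moreover have "sym_diff J I = {} \<longleftrightarrow> I = J" by blast
      ultimately show ?thesis
        using mem_colouring_diagram[OF f x(1)] by (simp only: sym_diff_eq_iff[of J I "{f x}"])
    qed
    have char: "I \<subseteq> {1..k} \<and> even (card I) \<and> rho n I z \<in> colouring_diagram k n f \<longleftrightarrow>
        even (card I) \<and> (I = J \<or> I = sym_diff J {f x})" for I
    proof (cases "I \<subseteq> {1..k}")
      case True
      then show ?thesis by (simp only: mem simp_thms)
    next
      case False
      then show ?thesis using x(2) i by auto
    qed
    have "even (card (sym_diff J {f x})) \<longleftrightarrow> odd (card J)"
      using even_card_sym_diff[of J "{f x}"] fin by simp
    then show ?thesis unfolding char by metis
  qed
  moreover have "colouring_diagram k n f \<subseteq> box k (\<lambda>i. 2 * n i)"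
    using box_subset_double_box rho_in_box colourings_range[OF f]
    by (fastforce simp: colouring_diagram_def)
  ultimately show ?thesis
    using downset_colouring_diagram[OF f] by (simp add: complementary_diagrams_def)
qed

lemma inj_on_colouring_diagram: "inj_on (colouring_diagram k n) (colourings k n)"
proof (rule inj_onI)
  fix f g
  assume f: "f \<in> colourings k n" and g: "g \<in> colourings k n"
    and eq: "colouring_diagram k n f = colouring_diagram k n g"
  show "f = g"
  proof (rule extensionalityI)
    show "f \<in> extensional (box k n)" "g \<in> extensional (box k n)"
      using f[THEN colourings_PiE] g[THEN colourings_PiE] by (auto simp: PiE_iff)
  next
    fix x assume x: "x \<in> box k n"
    have "{f x} \<subseteq> {1..k}" using colourings_range[OF f x] by simp
    then show "f x = g x"
      using mem_colouring_diagram[OF f x, of "{f x}"] mem_colouring_diagram[OF g x, of "{f x}"] eq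
      by auto
  qed
qed

section \<open>From diagrams back to colourings\<close>

lemma rho_mono_subset:
  assumes "x \<in> box k n" "I \<subseteq> J"
  shows "i \<in> {1..k} \<Longrightarrow> rho n I x i \<le> rho n J x i"
  using assms by (force simp: rho_def box_def PiE_iff)

text \<open>The colour of \<open>x\<close> is the unique direction whose reflection of
  \<open>x\<close> lies in \<open>L\<close>. It comes from the tiling condition, applied both at
  \<open>x\<close> and at one odd reflection of \<open>x\<close>.\<close>

lemma complementary_diagram_is_colouring_diagram:
  assumes L: "L \<in> complementary_diagrams k n" and "k > 0"
  obtains f where "f \<in> colourings k n" "colouring_diagram k n f = L"
proof -
  note L' = L[unfolded complementary_diagrams_def mem_Collect_eq]
  note down = L'[THEN conjunct1] and sub = L'[THEN conjunct2, THEN conjunct1]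
    and uniq = L'[THEN conjunct2, THEN conjunct2, THEN bspec]
  note dbl = subsetD[OF box_subset_double_box]
  \<comment> \<open>Reflecting a coordinate of the small box increases it, so reflecting fewer
    coordinates yields a smaller point and down-closure applies.\<close>
  have shrink: "rho n J x \<in> L" if "x \<in> box k n" "rho n I x \<in> L" "J \<subseteq> I" "I \<subseteq> {1..k}" for x I J
  proof (rule downsetD[OF down that(2)])
    show "rho n J x \<in> pos_points k"
      using rho_in_box[OF dbl[OF that(1)], of J] that box_subset_pos_points by blast
  qed (use rho_mono_subset[OF that(1,3)] in auto)
  \<comment> \<open>Some even reflection of \<open>x\<close> lies in \<open>L\<close>; undoing it
    stays in \<open>L\<close>.\<close>
  have base: "x \<in> L" if x: "x \<in> box k n" for x
    using uniq[OF dbl[OF x]] shrink[OF x, of _ "{}"] by auto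
  \<comment> \<open>Two reflected coordinates would make \<open>{}\<close> and \<open>{i, j}\<close>
    two even sets for the same \<open>x\<close>.\<close>
  have small: "I = {} \<or> (\<exists>i. I = {i})" if x: "x \<in> box k n" and I: "I \<subseteq> {1..k}" "rho n I x \<in> L" for x I
  proof (rule ccontr)
    assume "\<not> ?thesis"
    then obtain i j where ij: "i \<in> I" "j \<in> I" "i \<noteq> j" by blast
    then have "rho n {i, j} x \<in> L" using shrink[OF x I(2) _ I(1), of "{i, j}"] by simp
    moreover have "{i, j} \<subseteq> {1..k}" "even (card {i, j})" using ij I(1) by auto
    moreover have "rho n {} x \<in> L" using base[OF x] by simp
    ultimately have "{i, j} = {}" using uniq[OF dbl[OF x]] by (metis card.empty empty_subsetI even_zero)
    then show False by simp
  qed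
  have ex1: "\<exists>!i. i \<in> {1..k} \<and> rho n {i} x \<in> L" if x: "x \<in> box k n" for x
  proof -
    \<comment> \<open>Direction 1 is an arbitrary choice. Passing to \<open>rho n {1} x\<close>
      exchanges even and odd sets, so the tiling condition there speaks about odd reflections of
      \<open>x\<close>.\<close>
    have one: "{1} \<subseteq> {1..k}" using \<open>k > 0\<close> by auto
    let ?z = "rho n {1} x"
    have z: "rho n I ?z = rho n (sym_diff {1} I) x" for I using rho_rho[OF dbl[OF x] one] .
    have par: "even (card (sym_diff {1} I)) \<longleftrightarrow> odd (card I)" if "I \<subseteq> {1..k}" for I
      using even_card_sym_diff[of "{1}" I] finite_subset[OF that] by simp
    obtain I where I: "I \<subseteq> {1..k}" "even (card I)" "rho n I ?z \<in> L"
      and I_unique: "\<And>J. \<lbrakk>J \<subseteq> {1..k}; even (card J); rho n J ?z \<in> L\<rbrakk> \<Longrightarrow> J = I"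
      using uniq[OF rho_in_box[OF dbl[OF x] one]] by (elim ex1E) blast
    have sub: "sym_diff {1} I \<subseteq> {1..k}" using I(1) one by blast
    have mem: "rho n (sym_diff {1} I) x \<in> L" using I(3) by (simp only: z)
    have "odd (card (sym_diff {1} I))" using par[OF sub] I(2) by (simp only: sym_diff_cancel simp_thms)
    then have "sym_diff {1} I \<noteq> {}" by (metis card.empty even_zero)
    then obtain i where i: "sym_diff {1} I = {i}" using small[OF x sub mem] by blast
    show ?thesis
    proof (rule ex1I[of _ i])
      show "i \<in> {1..k} \<and> rho n {i} x \<in> L" using sub mem unfolding i by simp
    next
      fix j assume j: "j \<in> {1..k} \<and> rho n {j} x \<in> L"
      then have "{j} \<subseteq> {1..k}" by simp
      \<comment> \<open>Any candidate \<open>j\<close> yields an even set for \<open>?z\<close>, and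
        uniqueness there forces it to be \<open>I\<close>.\<close>
      then have "sym_diff {1} {j} = I"
        using j one par[of "{j}"] by (intro I_unique) (simp_all only: z sym_diff_cancel, auto)
      then have "{j} = sym_diff {1} I" by (rule sym_diff_eq_iff[THEN iffD1])
      then show "j = i" unfolding i by simp
    qed
  qed
  define f where "f = (\<lambda>x\<in>box k n. THE i. i \<in> {1..k} \<and> rho n {i} x \<in> L)"
  have f: "f x \<in> {1..k} \<and> rho n {f x} x \<in> L" if "x \<in> box k n" for x
    using theI'[OF ex1[OF that]] that by (simp add: f_def)
  have f_eq: "f x = i" if "x \<in> box k n" "i \<in> {1..k}" "rho n {i} x \<in> L" for x i
    using ex1[OF that(1)] f[OF that(1)] that by blast
  have "f y = f x"
    if x: "x \<in> box k n" and y: "y \<in> box k n"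
      and le: "x (f x) \<le> y (f x)" "\<forall>j\<in>{1..k} - {f x}. y j \<le> x j" for x y
  proof (rule f_eq[OF y])
    show "f x \<in> {1..k}" using f[OF x] by simp
    show "rho n {f x} y \<in> L"
    proof (rule downsetD[OF down])
      show "rho n {f x} x \<in> L" using f[OF x] by simp
      show "rho n {f x} y \<in> pos_points k"
        using rho_in_box[OF dbl[OF y], of "{f x}"] f[OF x] box_subset_pos_points by blast
    qed (use le in \<open>auto simp: rho_def\<close>)
  qed
  moreover have "f \<in> box k n \<rightarrow>\<^sub>E {1..k}" using f by (auto simp: f_def)
  ultimately have "f \<in> colourings k n" unfolding colourings_def by blast
  moreover have "colouring_diagram k n f = L"
  proof (intro equalityI subsetI)
    fix z assume "z \<in> colouring_diagram k n f"
    then show "z \<in> L" using base f by (auto simp: colouring_diagram_def)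
  next
    fix z assume z: "z \<in> L"
    then obtain x J where x: "x \<in> box k n" "J \<subseteq> {1..k}" "z = rho n J x"
      using folding sub by (metis subsetD)
    then consider "J = {}" | i where "J = {i}" using small z by blast
    then show "z \<in> colouring_diagram k n f"
    proof cases
      case 1
      then show ?thesis using x by (simp add: colouring_diagram_def)
    next
      case 2
      then have "f x = i" using f_eq x z by auto
      then show ?thesis using x 2 by (auto simp: colouring_diagram_def)
    qed
  qed
  ultimately show thesis by (rule that)
qed

text \<open>A direction must exist: in dimension 0 the one-point box is a complementary diagram but
  admits no colouring.\<close>

lemma card_complementary_diagrams:
  assumes "k > 0"
  shows "card (complementary_diagrams k n) = card (colourings k n)"
proof -
  have "colouring_diagram k n ` colourings k n = complementary_diagrams k n"
  proof (intro equalityI image_subsetI subsetI colouring_diagram_complementary)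
    fix L assume "L \<in> complementary_diagrams k n"
    then obtain f where "f \<in> colourings k n" "colouring_diagram k n f = L"
      using assms by (rule complementary_diagram_is_colouring_diagram)
    then show "L \<in> colouring_diagram k n ` colourings k n" by blast
  qed
  then show ?thesis using card_image[OF inj_on_colouring_diagram] by metis
qed

section \<open>The recursion for the number of colourings\<close>

lemma finite_colourings: "finite (colourings k n)"
proof (rule finite_subset)
  show "colourings k n \<subseteq> box k n \<rightarrow>\<^sub>E {1..k}" using colourings_PiE by blast
  have "finite (box k n)" by (auto simp: box_def intro: finite_PiE)
  then show "finite (box k n \<rightarrow>\<^sub>E {1..k})" by (simp add: finite_PiE)
qed

text \<open>The empty function is the only colouring here; this is the boundary value of the
  recursion.\<close>

lemma card_colourings_empty_box:
  assumes "j \<in> {1..k}" "n j = 0"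
  shows "card (colourings k n) = 1"
proof -
  have "box k n = {}" using assms by (auto simp: box_def PiE_eq_empty_iff)
  then show ?thesis by (simp add: colourings_def)
qed

lemma box_decr:
  assumes "i \<in> {1..k}" "n i > 0"
  shows "box k (n(i := n i - 1)) = {x \<in> box k n. x i \<noteq> n i}"
proof -
  have "(\<forall>j\<in>{1..k}. x j \<in> {1..(n(i := n i - 1)) j}) \<longleftrightarrow>
      (\<forall>j\<in>{1..k}. x j \<in> {1..n j}) \<and> x i \<noteq> n i" (is "?l \<longleftrightarrow> ?r") for x
  proof (intro iffI conjI ballI)
    fix j assume "?l" "j \<in> {1..k}"
    from bspec[OF this] show "x j \<in> {1..n j}" by (auto split: if_splits)
  next
    assume "?l"
    from bspec[OF this assms(1)] show "x i \<noteq> n i" using assms(2) by auto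
  next
    fix j assume r: "?r" and j: "j \<in> {1..k}"
    from bspec[OF conjunct1[OF r] j] show "x j \<in> {1..(n(i := n i - 1)) j}"
      using r by (cases "j = i") auto
  qed
  then show ?thesis unfolding box_def PiE_iff set_eq_iff mem_Collect_eq by blast
qed

text \<open>The colour of the corner spreads over the slice \<open>x i = n i\<close>, so restriction
  to the rest loses nothing. Conversely, filling the slice with \<open>i\<close> extends any
  colouring of the smaller box.\<close>

lemma card_colourings_corner:
  assumes pos: "\<And>i. i \<in> {1..k} \<Longrightarrow> n i > 0" and i: "i \<in> {1..k}"
  defines "t \<equiv> restrict n {1..k}" and "n' \<equiv> n(i := n i - 1)"
  shows "card {f \<in> colourings k n. f t = i} = card (colourings k n')"
proof (rule bij_betw_same_card)
  have t: "t \<in> box k n" using pos by (force simp: t_def box_def)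
  have sub: "box k n' = {x \<in> box k n. x i \<noteq> n i}"
    unfolding n'_def using i pos[OF i] by (rule box_decr)
  have le_n: "x j \<le> n j" if "x \<in> box k n" "j \<in> {1..k}" for x j
    using that by (auto simp: box_def)
  have slice: "f x = i" if f: "f \<in> colourings k n" "f t = i" and x: "x \<in> box k n" "x i = n i" for f x
  proof -
    have ti: "t j = n j" if "j \<in> {1..k}" for j using that by (simp add: t_def)
    \<comment> \<open>The corner \<open>t\<close> dominates every point of the box and agrees with
      \<open>x\<close> at coordinate \<open>i\<close>, so its colour passes to
      \<open>x\<close>.\<close>
    have "f x = f t"
      by (rule colouringsD[OF f(1) t x(1)]) (use f(2) i x ti le_n in simp_all)
    then show ?thesis using f(2) by simp
  qed
  let ?ext = "\<lambda>g. \<lambda>x\<in>box k n. if x i = n i then i else g x"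
  show "bij_betw (\<lambda>f. restrict f (box k n')) {f \<in> colourings k n. f t = i} (colourings k n')"
  proof (rule bij_betw_byWitness[where f' = ?ext])
    show "\<forall>f\<in>{f \<in> colourings k n. f t = i}. ?ext (restrict f (box k n')) = f"
    proof
      fix f assume "f \<in> {f \<in> colourings k n. f t = i}"
      then have f: "f \<in> colourings k n" "f t = i" by simp_all
      show "?ext (restrict f (box k n')) = f"
      proof (rule extensionalityI[of _ "box k n"])
        show "f \<in> extensional (box k n)" using colourings_PiE[OF f(1)] by (simp add: PiE_iff)
        show "?ext (restrict f (box k n')) x = f x" if "x \<in> box k n" for x
          using that slice[OF f that] sub by (cases "x i = n i") simp_all
      qed (rule restrict_extensional)
    qed
    show "\<forall>g\<in>colourings k n'. restrict (?ext g) (box k n') = g"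
    proof
      fix g assume g: "g \<in> colourings k n'"
      show "restrict (?ext g) (box k n') = g"
      proof (rule extensionalityI[of _ "box k n'"])
        show "g \<in> extensional (box k n')" using colourings_PiE[OF g] by (simp add: PiE_iff)
        show "restrict (?ext g) (box k n') x = g x" if "x \<in> box k n'" for x
          using that unfolding sub by simp
      qed (rule restrict_extensional)
    qed
    show "(\<lambda>f. restrict f (box k n')) ` {f \<in> colourings k n. f t = i} \<subseteq> colourings k n'"
    proof (rule image_subsetI)
      fix f assume "f \<in> {f \<in> colourings k n. f t = i}"
      then have f: "f \<in> colourings k n" by simp
      have "restrict f (box k n') \<in> box k n' \<rightarrow>\<^sub>E {1..k}"
        using colourings_range[OF f] sub by auto
      then show "restrict f (box k n') \<in> colourings k n'"
        using f sub unfolding colourings_def by simp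
    qed
    show "?ext ` colourings k n' \<subseteq> {f \<in> colourings k n. f t = i}"
    proof (rule image_subsetI)
      fix g assume g: "g \<in> colourings k n'"
      have "?ext g \<in> box k n \<rightarrow>\<^sub>E {1..k}"
        using colourings_range[OF g] i sub by auto
      moreover have "?ext g y = ?ext g x"
        if x: "x \<in> box k n" and y: "y \<in> box k n"
          and le: "x (?ext g x) \<le> y (?ext g x)" "\<forall>j\<in>{1..k} - {?ext g x}. y j \<le> x j" for x y
      proof (cases "x i = n i")
        case True
        \<comment> \<open>Propagation of colour \<open>i\<close> from the slice requires
          \<open>y i \<ge> n i\<close>, so \<open>y\<close> is on the slice too.\<close>
        then have "y i = n i" using le(1) x assms(1) le_n[OF y i] by simp
        then show ?thesis using True x y by simp
      next
        case False
        then have gx: "?ext g x = g x" and x': "x \<in> box k n'" using x sub by auto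
        show ?thesis
        proof (cases "y i = n i")
          case True
          \<comment> \<open>Another colour would require \<open>y i \<le> x i\<close>, impossible
            with \<open>y\<close> on the slice and \<open>x\<close> off it.\<close>
          have "g x = i"
          proof (rule ccontr)
            assume "g x \<noteq> i"
            then have "y i \<le> x i" using le(2) i gx by auto
            then show False using True False le_n[OF x i] by simp
          qed
          then show ?thesis using gx True y by simp
        next
          case F: False
          then have y': "y \<in> box k n'" using y sub by auto
          have "g y = g x"
            by (rule colouringsD[OF g x' y']) (use le gx in auto)
          then show ?thesis using gx F y by simp
        qed
      qed
      ultimately have "?ext g \<in> colourings k n" unfolding colourings_def by blast
      moreover have "?ext g t = i" using t i by (simp add: t_def)
      ultimately show "?ext g \<in> {f \<in> colourings k n. f t = i}" by simp
    qed
  qed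
qed

lemma card_colourings_rec:
  assumes pos: "\<And>i. i \<in> {1..k} \<Longrightarrow> n i > 0"
  shows "card (colourings k n) = (\<Sum>i\<in>{1..k}. card (colourings k (n(i := n i - 1))))"
proof -
  let ?t = "restrict n {1..k}"
  have t: "?t \<in> box k n" using pos by (force simp: box_def)
  have "colourings k n = (\<Union>i\<in>{1..k}. {f \<in> colourings k n. f ?t = i})"
    using colourings_range[OF _ t] by auto
  then have "card (colourings k n) = card (\<Union>i\<in>{1..k}. {f \<in> colourings k n. f ?t = i})"
    by (rule arg_cong)
  also have "\<dots> = (\<Sum>i\<in>{1..k}. card {f \<in> colourings k n. f ?t = i})"
    by (rule card_UN_disjoint) (auto simp: finite_colourings)
  also have "\<dots> = (\<Sum>i\<in>{1..k}. card (colourings k (n(i := n i - 1))))"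
    using card_colourings_corner[OF pos] by (intro sum.cong) auto
  finally show ?thesis .
qed


section \<open>The generating function\<close>

lemma keys_minus_single:
  fixes n :: "nat \<Rightarrow>\<^sub>0 nat"
  assumes "i \<in> Poly_Mapping.keys n"
  shows "Poly_Mapping.keys (n - Poly_Mapping.single i 1) =
    (if Poly_Mapping.lookup n i = 1 then Poly_Mapping.keys n - {i} else Poly_Mapping.keys n)"
  using assms by (auto simp: in_keys_iff lookup_minus lookup_single when_def split: if_splits)

lemma lookup_minus_single:
  "Poly_Mapping.lookup (n - Poly_Mapping.single i 1) =
     (Poly_Mapping.lookup n)(i := Poly_Mapping.lookup n i - (1 :: nat))"
  by (auto simp: fun_eq_iff lookup_minus lookup_single when_def)

lemma mfps_X_mult_nth:
  fixes f :: "'a :: comm_ring_1 mfps"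
  shows "mfps_nth (mfps_X i * f) n =
    (if i \<in> Poly_Mapping.keys n then mfps_nth f (n - Poly_Mapping.single i 1) else 0)"
proof -
  let ?e = "Poly_Mapping.single i (1 :: nat)"
  have split: "a + b = n \<and> a = ?e \<longleftrightarrow> i \<in> Poly_Mapping.keys n \<and> a = ?e \<and> b = n - ?e" for a b
  proof -
    have "?e + (n - ?e) = n" if "i \<in> Poly_Mapping.keys n"
      using that
      by (intro poly_mapping_eqI) (auto simp: in_keys_iff lookup_add lookup_minus lookup_single when_def)
    moreover have "i \<in> Poly_Mapping.keys (?e + b)"
      by (simp add: in_keys_iff lookup_add lookup_single)
    ultimately show ?thesis by auto
  qed
  have "mfps_nth (mfps_X i * f) n =
      (\<Sum>(a, b) \<in> {(a, b). a + b = n}. if a = ?e then mfps_nth f b else 0)"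
    unfolding mfps_mult_nth mfps_X_def by (intro sum.cong) auto
  also have "\<dots> = (\<Sum>(a, b) \<in> {(a, b). a + b = n \<and> a = ?e}. mfps_nth f b)"
    by (rule sum.mono_neutral_cong_right) (auto simp: finite_splits split: if_splits)
  also have "{(a, b). a + b = n \<and> a = ?e} =
      (if i \<in> Poly_Mapping.keys n then {(?e, n - ?e)} else {})"
    unfolding split by auto
  finally show ?thesis by (simp split: if_splits)
qed

lemma mfps_sum_nth [simp]: "mfps_nth (sum f A) n = (\<Sum>i\<in>A. mfps_nth (f i) n)"
  by (induction A rule: infinite_finite_induct) auto

text \<open>For finite \<open>A\<close> this is the expansion of the product of
  \<open>X_i / (1 - X_i)\<close> over \<open>A\<close>, as \<open>mfps_support_prod\<close>
  shows.\<close>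

definition mfps_support :: "nat set \<Rightarrow> 'a :: comm_ring_1 mfps" where
  "mfps_support A = Abs_mfps (\<lambda>n. if Poly_Mapping.keys n = A then 1 else 0)"

lemma mfps_support_nth [simp]:
  "mfps_nth (mfps_support A) n = (if Poly_Mapping.keys n = A then 1 else 0)"
  by (simp add: mfps_support_def)

text \<open>Multiplying by \<open>1 - mfps_X i\<close> subtracts the shift by one in direction
  \<open>i\<close>; only the monomials with exponent exactly 1 there survive.\<close>

lemma mfps_support_insert:
  assumes "i \<notin> A"
  shows "mfps_support (insert i A) * (1 - mfps_X i) = mfps_X i * mfps_support A"
proof (rule mfps_eqI)
  fix n
  have "mfps_nth (mfps_support (insert i A) * (1 - mfps_X i)) n =
      mfps_nth (mfps_support (insert i A) - mfps_X i * mfps_support (insert i A)) n"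
    by (simp add: algebra_simps)
  also have "\<dots> = mfps_nth (mfps_X i * mfps_support A) n"
    using assms by (auto simp: mfps_X_mult_nth keys_minus_single simp del: One_nat_def)
  finally show "mfps_nth (mfps_support (insert i A) * (1 - mfps_X i)) n =
      mfps_nth (mfps_X i * mfps_support A) n" .
qed

lemma mfps_support_prod:
  assumes "finite A"
  shows "(mfps_support A :: 'a :: comm_ring_1 mfps) * (\<Prod>i\<in>A. 1 - mfps_X i) = (\<Prod>i\<in>A. mfps_X i)"
  using assms
proof (induction A rule: finite_induct)
  case empty
  show ?case by (intro mfps_eqI) simp
next
  case (insert i A)
  have "(mfps_support (insert i A) :: 'a mfps) * (\<Prod>j\<in>insert i A. 1 - mfps_X j) =
      (mfps_support (insert i A) * (1 - mfps_X i)) * (\<Prod>j\<in>A. 1 - mfps_X j)"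
    using insert.hyps by (simp add: mult.assoc)
  also have "\<dots> = mfps_X i * (mfps_support A * (\<Prod>j\<in>A. 1 - mfps_X j))"
    by (simp add: mfps_support_insert[OF insert.hyps(2)] mult.assoc)
  also have "\<dots> = (\<Prod>j\<in>insert i A. mfps_X j)"
    using insert.hyps by (simp add: insert.IH)
  finally show ?case .
qed

section \<open>The recursion as an equation between series\<close>

definition interior_series :: "nat \<Rightarrow> int mfps" where
  "interior_series k =
     Abs_mfps (\<lambda>n. if Poly_Mapping.keys n = {1..k}
       then int (card (colourings k (Poly_Mapping.lookup n))) else 0)"

lemma interior_series_nth [simp]:
  "mfps_nth (interior_series k) n =
     (if Poly_Mapping.keys n = {1..k} then int (card (colourings k (Poly_Mapping.lookup n))) else 0)"
  by (simp add: interior_series_def)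

text \<open>Multiplication by \<open>mfps_X i\<close> lowers the \<open>i\<close>-th exponent to be
  looked up. The lowered vector is interior unless that exponent has become 0, where the support
  series supplies the value 1 of the empty box.\<close>

lemma interior_series_rec:
  "interior_series k =
     (\<Sum>i\<in>{1..k}. mfps_X i * (interior_series k + mfps_support ({1..k} - {i})))"
proof (rule mfps_eqI)
  fix n
  have step: "mfps_nth (mfps_X i * (interior_series k + mfps_support ({1..k} - {i}))) n =
      (if Poly_Mapping.keys n = {1..k}
       then int (card (colourings k ((Poly_Mapping.lookup n)(i := Poly_Mapping.lookup n i - 1))))
       else 0)" if i: "i \<in> {1..k}" for i
  proof (cases "i \<in> Poly_Mapping.keys n")
    case False
    then have "Poly_Mapping.keys n \<noteq> {1..k}" using i by blast
    then show ?thesis using False by (simp only: mfps_X_mult_nth if_False)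
  next
    case True
    have ne: "{1..k} \<noteq> {1..k} - {i}" using i by blast
    show ?thesis
    proof (cases "Poly_Mapping.lookup n i = 1")
      case one: True
      have "Poly_Mapping.keys n - {i} = {1..k} - {i} \<longleftrightarrow> Poly_Mapping.keys n = {1..k}"
        using True i by blast
      moreover have "Poly_Mapping.keys n - {i} \<noteq> {1..k}" using i by blast
      moreover have "card (colourings k ((Poly_Mapping.lookup n)(i := 0))) = 1"
        using i by (intro card_colourings_empty_box[of i]) auto
      ultimately show ?thesis
        using True by (simp only: mfps_X_mult_nth keys_minus_single one mfps_add_nth
            interior_series_nth mfps_support_nth) (simp add: one)
    next
      case False
      \<comment> \<open>Here the exponent is at least 2, so the shift keeps \<open>i\<close> in the
        support and the boundary term vanishes.\<close>
      have "Poly_Mapping.keys n \<noteq> {1..k} - {i}" using True by blast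
      then show ?thesis
        using True False ne
        by (simp add: mfps_X_mult_nth keys_minus_single lookup_minus_single del: One_nat_def)
    qed
  qed
  show "mfps_nth (interior_series k) n =
      mfps_nth (\<Sum>i\<in>{1..k}. mfps_X i * (interior_series k + mfps_support ({1..k} - {i}))) n"
  proof (cases "Poly_Mapping.keys n = {1..k}")
    case True
    then have "card (colourings k (Poly_Mapping.lookup n)) = (\<Sum>i\<in>{1..k}.
        card (colourings k ((Poly_Mapping.lookup n)(i := Poly_Mapping.lookup n i - 1))))"
      by (intro card_colourings_rec) (metis in_keys_iff gr0I)
    then show ?thesis using True by (simp only: mfps_sum_nth step cong: sum.cong) simp
  next
    case False
    then show ?thesis by (simp only: mfps_sum_nth step cong: sum.cong) simp
  qed
qed

lemma sum_if_one_eq_card: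
  assumes "finite A"
  shows "(\<Sum>x\<in>A. if P x then 1 else 0) = int (card {x \<in> A. P x})"
  using assms by (simp add: sum.If_cases Int_def)

text \<open>Exponents are sorted by their zero entries: none gives the interior part, one gives
  coefficient 1 in the support series of the remaining variables, two or more give 0 by
  convention.\<close>

lemma FCP_series_decomp:
  "FCP_series d =
     interior_series (d + 1) + (\<Sum>j\<in>{1..d + 1}. mfps_support ({1..d + 1} - {j}))"
proof (rule mfps_eqI)
  fix n :: "nat \<Rightarrow>\<^sub>0 nat"
  let ?K = "{1..d + 1}" and ?n = "Poly_Mapping.lookup n"
  let ?Z = "{i \<in> ?K. ?n i = 0}"
  have Z: "?Z = ?K - Poly_Mapping.keys n" by (auto simp: in_keys_iff)
  have rhs: "mfps_nth (interior_series (d + 1) + (\<Sum>j\<in>?K. mfps_support (?K - {j}))) n =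
      (if Poly_Mapping.keys n = ?K then int (card (colourings (d + 1) ?n)) else 0) +
      int (card {j \<in> ?K. Poly_Mapping.keys n = ?K - {j}})"
    by (simp only: mfps_add_nth mfps_sum_nth interior_series_nth mfps_support_nth
        sum_if_one_eq_card finite_atLeastAtMost)
  show "mfps_nth (FCP_series d) n =
      mfps_nth (interior_series (d + 1) + (\<Sum>j\<in>?K. mfps_support (?K - {j}))) n"
  proof (cases "Poly_Mapping.keys n \<subseteq> ?K")
    case False
    then have "{j \<in> ?K. Poly_Mapping.keys n = ?K - {j}} = {}" "Poly_Mapping.keys n \<noteq> ?K" by blast+
    then show ?thesis unfolding rhs FCP_series_def mfps_nth_Abs_mfps using False by simp
  next
    case sub: True
    then have lhs: "mfps_nth (FCP_series d) n = int (card (FCP d ?n))"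
      unfolding FCP_series_def mfps_nth_Abs_mfps by simp
    consider "?Z = {}" | j where "?Z = {j}" | "card ?Z \<ge> 2"
    proof -
      have "card ?Z = 0 \<or> card ?Z = 1 \<or> card ?Z \<ge> 2" by linarith
      then show thesis using that by (metis (no_types, lifting) card_0_eq card_1_singletonE
            finite_Diff finite_atLeastAtMost Z)
    qed
    then show ?thesis
    proof cases
      case 1
      then have keys: "Poly_Mapping.keys n = ?K" using sub Z by blast
      then have "{j \<in> ?K. Poly_Mapping.keys n = ?K - {j}} = {}" by blast
      moreover have "card (FCP d ?n) = card (colourings (d + 1) ?n)"
        using card_FCP_eq_diagrams[of d ?n] card_complementary_diagrams[of "d + 1" ?n] keys
        by (metis add_gr_0 gr0I in_keys_iff zero_less_one)
      ultimately show ?thesis unfolding rhs lhs using keys by simp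
    next
      case 2
      then have j: "j \<in> ?K" "Poly_Mapping.keys n = ?K - {j}" using sub unfolding Z by blast+
      then have "{i \<in> ?K. Poly_Mapping.keys n = ?K - {i}} = {j}" "Poly_Mapping.keys n \<noteq> ?K" by blast+
      moreover have "card (FCP d ?n) = 1" using FCP_one_zero[of d ?n] 2 by simp
      ultimately show ?thesis unfolding rhs lhs by simp
    next
      case 3
      have "Poly_Mapping.keys n \<noteq> ?K - {i}" if "i \<in> ?K" for i
      proof
        assume "Poly_Mapping.keys n = ?K - {i}"
        then have "?Z = {i}" using that unfolding Z by blast
        then show False using 3 by simp
      qed
      then have "{j \<in> ?K. Poly_Mapping.keys n = ?K - {j}} = {}" by blast
      moreover have "Poly_Mapping.keys n \<noteq> ?K" using 3 Z by auto
      moreover have "FCP d ?n = {}" using 3 by (simp add: FCP_def)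
      ultimately show ?thesis unfolding rhs lhs by simp
    qed
  qed
qed

text \<open>Denominators are cleared, so the computation stays in the ring of series; the product
  over \<open>K - {i}\<close> stands for the full product divided by \<open>X i\<close>.\<close>

lemma FCP_series_identity:
  fixes d :: nat
  defines "K \<equiv> {1..d + 1}" and "X \<equiv> mfps_X :: nat \<Rightarrow> int mfps"
  shows "FCP_series d * ((1 - (\<Sum>i\<in>K. X i)) * (\<Prod>i\<in>K. 1 - X i)) =
    (1 - (\<Sum>i\<in>K. X i)) * (\<Sum>i\<in>K. \<Prod>j\<in>K - {i}. X j) + of_nat d * (\<Sum>i\<in>K. X i) * (\<Prod>i\<in>K. X i)"
proof -
  define S where "S = (\<Sum>i\<in>K. X i)"
  define P where "P = (\<Prod>i\<in>K. X i)"
  define Q where "Q = (\<Prod>i\<in>K. 1 - X i)"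
  define R where "R i = (\<Prod>j\<in>K - {i}. X j)" for i
  define Z where "Z i = (mfps_support (K - {i}) :: int mfps)" for i
  define D where "D = interior_series (d + 1)"
  have fin: "finite K" and card: "card K = d + 1" by (auto simp: K_def)
  have ZQ: "Z i * Q = (1 - X i) * R i" if "i \<in> K" for i
  proof -
    have "Q = (1 - X i) * (\<Prod>j\<in>K - {i}. 1 - X j)"
      unfolding Q_def using fin that by (rule prod.remove)
    then have "Z i * Q = (1 - X i) * (mfps_support (K - {i}) * (\<Prod>j\<in>K - {i}. 1 - X j))"
      by (simp only: Z_def mult_ac)
    then show ?thesis using fin by (simp add: R_def X_def mfps_support_prod)
  qed
  have P: "X i * R i = P" if "i \<in> K" for i
    unfolding P_def R_def using fin that by (rule prod.remove[symmetric])
  have XZQ: "X i * Z i * Q = P - X i * P" if "i \<in> K" for i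
  proof -
    have "X i * Z i * Q = X i * ((1 - X i) * R i)" by (simp only: mult.assoc ZQ[OF that])
    also have "\<dots> = (1 - X i) * (X i * R i)" by (simp only: mult_ac)
    also have "\<dots> = (1 - X i) * P" by (simp only: P[OF that])
    finally show ?thesis by (simp add: left_diff_distrib)
  qed
  have ZQ': "Z i * Q = R i - P" if "i \<in> K" for i
    using ZQ[OF that] P[OF that] by (simp add: algebra_simps)
  \<comment> \<open>\<open>D\<close> occurs on both sides of the recursion; moving
    \<open>S * D\<close> to the left isolates it.\<close>
  have D: "(1 - S) * D = (\<Sum>i\<in>K. X i * Z i)"
  proof -
    have "D = (\<Sum>i\<in>K. X i * (D + Z i))"
      unfolding D_def K_def X_def Z_def by (rule interior_series_rec)
    also have "\<dots> = S * D + (\<Sum>i\<in>K. X i * Z i)"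
      by (simp add: S_def sum.distrib sum_distrib_right distrib_left)
    finally show ?thesis by (simp add: algebra_simps)
  qed
  have F: "FCP_series d = D + (\<Sum>i\<in>K. Z i)"
    unfolding D_def K_def Z_def by (rule FCP_series_decomp)
  \<comment> \<open>The term with \<open>d\<close> arises from a partial cancellation between the
    interior and boundary parts:
    \<open>(d + 1) * P - S * P - (1 - S) * (d + 1) * P = d * S * P\<close>.\<close>
  have "FCP_series d * ((1 - S) * Q) = (1 - S) * D * Q + (1 - S) * ((\<Sum>i\<in>K. Z i) * Q)"
    by (simp add: F algebra_simps)
  also have "(1 - S) * D * Q = (\<Sum>i\<in>K. P - X i * P)"
    unfolding D by (simp add: sum_distrib_right XZQ)
  also have "\<dots> = of_nat (d + 1) * P - S * P"
    by (simp add: sum_subtractf card S_def sum_distrib_right)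
  also have "(\<Sum>i\<in>K. Z i) * Q = (\<Sum>i\<in>K. R i) - of_nat (d + 1) * P"
    by (simp add: sum_distrib_right ZQ' sum_subtractf card)
  finally show ?thesis
    unfolding S_def[symmetric] P_def[symmetric] Q_def[symmetric] R_def[symmetric]
    by (simp add: algebra_simps)
qed

section \<open>Passage to the field of fractions\<close>

lemma to_fract_prod: "to_fract (prod f A) = (\<Prod>i\<in>A. to_fract (f i))"
  by (induction A rule: infinite_finite_induct) auto

lemma to_fract_of_nat: "to_fract (of_nat n) = of_nat n"
  by (induction n) auto

lemma mfps_X_nth_0 [simp]: "mfps_nth (mfps_X i) 0 = 0"
proof -
  have "(0 :: nat \<Rightarrow>\<^sub>0 nat) \<noteq> Poly_Mapping.single i 1"
    by (metis lookup_single_eq lookup_zero zero_neq_one)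
  then show ?thesis by (simp add: mfps_X_def)
qed

lemma mfps_X_nonzero: "mfps_X i \<noteq> (0 :: 'a :: comm_ring_1 mfps)"
proof
  assume "mfps_X i = (0 :: 'a mfps)"
  then have "mfps_nth (mfps_X i) (Poly_Mapping.single i 1) = (0 :: 'a)" by simp
  then show False by (simp add: mfps_X_def)
qed

text \<open>The identity of series is mapped to the field and divided by its denominator, which is
  nonzero because every factor has constant coefficient 1.\<close>

theorem theorem1p1:
  fixes d :: nat and x :: "nat \<Rightarrow> int mfps fract"
  assumes "\<And>i. x i = to_fract (mfps_X i)"
  shows "to_fract (FCP_series d) =
    ((\<Prod>i=1..d+1. x i) *
       ((\<Sum>i=1..d+1. inverse (x i) + of_nat d * x i)
        - (\<Sum>i=1..d+1. \<Sum>j=1..d+1. x i * inverse (x j))))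
    / ((1 - (\<Sum>i=1..d+1. x i)) * (\<Prod>i=1..d+1. 1 - x i))"
proof -
  define K where "K = {1..d + 1}"
  have fin: "finite K" by (simp add: K_def)
  have x0: "x i \<noteq> 0" for i by (simp add: assms mfps_X_nonzero)
  have S0: "1 - (\<Sum>i\<in>K. x i) \<noteq> 0"
  proof -
    have "mfps_nth (1 - (\<Sum>i\<in>K. mfps_X i :: int mfps)) 0 \<noteq> 0" by simp
    then have "1 - (\<Sum>i\<in>K. mfps_X i :: int mfps) \<noteq> 0" by (metis mfps_zero_nth)
    moreover have "1 - (\<Sum>i\<in>K. x i) = to_fract (1 - (\<Sum>i\<in>K. mfps_X i))" by (simp add: assms)
    ultimately show ?thesis by (simp only: to_fract_eq_0_iff not_False_eq_True)
  qed
  have Q0: "(\<Prod>i\<in>K. 1 - x i) \<noteq> 0"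
  proof -
    have "1 - x i \<noteq> 0" for i
    proof -
      have "mfps_nth (1 - mfps_X i :: int mfps) 0 \<noteq> 0" by simp
      then have "1 - mfps_X i \<noteq> (0 :: int mfps)" by (metis mfps_zero_nth)
      moreover have "1 - x i = to_fract (1 - mfps_X i)" by (simp add: assms)
      ultimately show ?thesis by (simp only: to_fract_eq_0_iff not_False_eq_True)
    qed
    then show ?thesis using fin by simp
  qed
  have R: "(\<Prod>j\<in>K - {i}. x j) = (\<Prod>j\<in>K. x j) * inverse (x i)" if "i \<in> K" for i
    using prod.remove[OF fin that, of x] x0[of i] by simp
  have R_sum: "(\<Sum>i\<in>K. \<Prod>j\<in>K - {i}. x j) = (\<Prod>i\<in>K. x i) * (\<Sum>i\<in>K. inverse (x i))"
    by (simp add: R sum_distrib_left)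
  have "to_fract (FCP_series d) * ((1 - (\<Sum>i\<in>K. x i)) * (\<Prod>i\<in>K. 1 - x i)) =
      (1 - (\<Sum>i\<in>K. x i)) * (\<Sum>i\<in>K. \<Prod>j\<in>K - {i}. x j) + of_nat d * (\<Sum>i\<in>K. x i) * (\<Prod>i\<in>K. x i)"
    using arg_cong[OF FCP_series_identity[of d], of to_fract]
    by (simp add: to_fract_prod to_fract_of_nat assms K_def)
  also have "\<dots> = (\<Prod>i\<in>K. x i) * ((1 - (\<Sum>i\<in>K. x i)) * (\<Sum>i\<in>K. inverse (x i)) +
      of_nat d * (\<Sum>i\<in>K. x i))"
    by (simp add: R_sum algebra_simps)
  \<comment> \<open>The sum of the \<open>x i\<close> times the sum of the inverses expands to the
    double sum over all pairs, diagonal included.\<close>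
  also have "(1 - (\<Sum>i\<in>K. x i)) * (\<Sum>i\<in>K. inverse (x i)) + of_nat d * (\<Sum>i\<in>K. x i) =
      (\<Sum>i\<in>K. inverse (x i) + of_nat d * x i) - (\<Sum>i\<in>K. \<Sum>j\<in>K. x i * inverse (x j))"
    unfolding sum_product[symmetric] by (simp add: sum.distrib sum_distrib_left left_diff_distrib sum_subtractf)
  finally show ?thesis
    unfolding K_def[symmetric] by (intro nonzero_eq_divide_eq[OF no_zero_divisors[OF S0 Q0], THEN iffD2])
qed

end
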